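(* Let $\mathcal{H}$ be a clutter of rank at most $r$ and let $\mathcal{S}$ be a semi-matching of $\mathcal{H}$. Then there is an expanded minor matching $\mathcal{S}'\subseteq\mathcal{S}$ of $\mathcal{H}$ of size at least $|\mathcal{S}|\,2^{-(r-2)}/(2r-3)$.
   Context: A clutter is a finite set of finite subsets of $\mathbb{N}$ that are pairwise incomparable under inclusion. The rank of $\mathcal{H}$ is $\max_{S\in\mathcal{H}}|S|$. For a clutter $\mathcal{H}$ and a set of pairs $\mathcal{S} = \{(L_i,S_i)\}_{i=1}^k$ consider the conditions: (1) $|L_i| = 2$, $L_i\subseteq S_i$ and $S_i\in\mathcal{H}$ for each $1\le i\le k$; (2) the sets $L_1,\dots,L_k$ are pairwise disjoint; (3a) $L_i\not\subseteq S_j$ for $i\ne j$; (3b) $L_i\cap S_j = \emptyset$ for $i\ne j$; (4) every set $S\in\mathcal{H}$ contained in $\bigcup_i S_i$ contains at least one $L_i$ as a subset. $\mathcal{S}$ is a semi-matching of $\mathcal{H}$ if it satisfies (1), (2), (3a) and (4), and an expanded minor matching of $\mathcal{H}$ if it additionally satisfies (3b). The size of $\mathcal{S}$ is the number $|\mathcal{S}|$ of its pairs. *)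

theory Defs
  imports Complex_Main
begin

definition clutter :: "nat set set \<Rightarrow> bool" where
  "clutter H \<longleftrightarrow> finite H \<and> (\<forall>S\<in>H. finite S) \<and>
     (\<forall>S\<in>H. \<forall>T\<in>H. S \<subseteq> T \<longrightarrow> S = T)"

(* The maximum is undefined for the empty clutter; its rank is taken to be 0. *)
definition clutter_rank :: "nat set set \<Rightarrow> nat" where
  "clutter_rank H = (if H = {} then 0 else Max (card ` H))"

(* The family (L_1,S_1), ..., (L_k,S_k) is encoded as the finite set M of its pairs.
   Nothing is lost: disjointness of the two-element sets L_i forbids repeated pairs,
   so indices i \<noteq> j correspond to distinct pairs in M. *)
definition semi_matching :: "nat set set \<Rightarrow> (nat set \<times> nat set) set \<Rightarrow> bool" where
  "semi_matching H M \<longleftrightarrow> finite M \<and>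
     (\<forall>(L, S)\<in>M. card L = 2 \<and> L \<subseteq> S \<and> S \<in> H) \<and>
     (\<forall>p\<in>M. \<forall>q\<in>M. p \<noteq> q \<longrightarrow> fst p \<inter> fst q = {}) \<and>
     (\<forall>p\<in>M. \<forall>q\<in>M. p \<noteq> q \<longrightarrow> \<not> fst p \<subseteq> snd q) \<and>
     (\<forall>S\<in>H. S \<subseteq> (\<Union>p\<in>M. snd p) \<longrightarrow> (\<exists>p\<in>M. fst p \<subseteq> S))"

definition expanded_minor_matching ::
    "nat set set \<Rightarrow> (nat set \<times> nat set) set \<Rightarrow> bool" where
  "expanded_minor_matching H M \<longleftrightarrow> semi_matching H M \<and>
     (\<forall>p\<in>M. \<forall>q\<in>M. p \<noteq> q \<longrightarrow> fst p \<inter> snd q = {})"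

end

theory Submission
  imports Defs "HOL-Library.FuncSet"
begin

text \<open>
  Passing to a subfamily \<open>I\<close> of a semi-matching can only destroy condition (4): a set
  \<open>S \<in> H\<close> inside \<open>\<Union>\<^bsub>i\<in>I\<^esub> S\<^sub>i\<close> still contains some \<open>L\<^sub>p\<close>, but \<open>p\<close> may have been discarded.
  This cannot happen if, for every discarded \<open>p\<close>, some element of \<open>L\<^sub>p\<close> is missed by all
  \<open>S\<^sub>i\<close> with \<open>i \<in> I\<close>. So choose an element \<open>c\<^sub>p\<close> of each \<open>L\<^sub>p\<close> uniformly and independently
  at random, and let \<open>J\<close> consist of those \<open>i\<close> for which \<open>S\<^sub>i\<close> avoids every \<open>c\<^sub>p\<close> with
  \<open>p \<noteq> i\<close>. Any subfamily of \<open>J\<close> is again a semi-matching. The sets \<open>L\<^sub>p\<close> are disjoint and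
  \<open>S\<^sub>i\<close> has at most \<open>r - 2\<close> elements outside \<open>L\<^sub>i\<close>, so \<open>S\<^sub>i\<close> meets at most \<open>r - 2\<close> of the
  other \<open>L\<^sub>p\<close>, each in a single element by (3a); hence \<open>i \<in> J\<close> with probability at least
  \<open>2\<^bsup>-(r-2)\<^esup>\<close>, and some choice of \<open>c\<close> makes \<open>J\<close> at least as large as the mean
  (\<open>exists_widely_avoided_transversal\<close>).

  Condition (3b) asks for an independent set in the digraph on \<open>J\<close> with an arc from \<open>i\<close> to
  \<open>p\<close> whenever \<open>S\<^sub>i\<close> meets \<open>L\<^sub>p\<close>. Out-degrees are at most \<open>r - 2\<close>, so the greedy
  algorithm, always taking a vertex of least total degree, finds one containing at least
  a fraction \<open>1 / (2 (r - 2) + 1)\<close> of the vertices (\<open>exists_large_independent_set\<close>).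
\<close>

text \<open>
  The arcs number at most \<open>d\<close> times the vertices, so some vertex has at most \<open>2 d\<close>
  neighbours in total. Taking that vertex and deleting it with its neighbours costs at
  most \<open>2 d + 1\<close> vertices, and the out-degree bound survives in what remains.
\<close>

lemma exists_large_independent_set:
  assumes "finite V"
    and "\<And>v. v \<in> V \<Longrightarrow> card {w \<in> V. w \<noteq> v \<and> E v w} \<le> d"
  shows "\<exists>I \<subseteq> V. (\<forall>v\<in>I. \<forall>w\<in>I. v \<noteq> w \<longrightarrow> \<not> E v w) \<and> card V \<le> (2 * d + 1) * card I"
  using assms
proof (induction V rule: finite_psubset_induct)
  case (psubset V)
  show ?case
  proof (cases "V = {}")
    case True
    then show ?thesis by auto
  next
    case False
    let ?out = "\<lambda>v. {w \<in> V. w \<noteq> v \<and> E v w}"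
    let ?in = "\<lambda>v. {w \<in> V. w \<noteq> v \<and> E w v}"
    have "(\<Sum>v\<in>V. card (?in v)) = (\<Sum>v\<in>V. \<Sum>w\<in>V. if w \<noteq> v \<and> E w v then 1 else 0)"
      using psubset.hyps by (simp add: sum.If_cases Int_def)
    also have "\<dots> = (\<Sum>w\<in>V. \<Sum>v\<in>V. if v \<noteq> w \<and> E w v then 1 else 0)"
      by (subst sum.swap) (simp add: eq_commute)
    also have "\<dots> = (\<Sum>v\<in>V. card (?out v))"
      using psubset.hyps by (simp add: sum.If_cases Int_def)
    finally have in_out: "(\<Sum>v\<in>V. card (?in v)) = (\<Sum>v\<in>V. card (?out v))" .
    have "(\<Sum>v\<in>V. card (?out v)) \<le> (\<Sum>v\<in>V. d)"
      using psubset.prems by (intro sum_mono) auto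
    with in_out have "(\<Sum>v\<in>V. card (?out v) + card (?in v)) \<le> (\<Sum>v\<in>V. 2 * d)"
      by (simp add: sum.distrib)
    then have "\<exists>v\<in>V. card (?out v) + card (?in v) \<le> 2 * d"
      using sum_strict_mono[OF psubset.hyps False, of "\<lambda>_. 2 * d"]
      by (meson not_less)
    then obtain v where v: "v \<in> V" "card (?out v) + card (?in v) \<le> 2 * d"
      by blast
    let ?N = "insert v (?out v \<union> ?in v)"
    have "card ?N \<le> Suc (card (?out v \<union> ?in v))"
      by (rule card_insert_le_m1) auto
    also have "card (?out v \<union> ?in v) \<le> 2 * d"
      using card_Un_le[of "?out v" "?in v"] v(2) by linarith
    finally have N: "card ?N \<le> 2 * d + 1"
      by simp
    have sub: "?N \<subseteq> V"
      using v(1) by auto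
    have "card {w \<in> V - ?N. w \<noteq> u \<and> E u w} \<le> d" if "u \<in> V - ?N" for u
    proof -
      have "card {w \<in> V - ?N. w \<noteq> u \<and> E u w} \<le> card (?out u)"
        using psubset.hyps by (intro card_mono) auto
      then show ?thesis
        using psubset.prems[of u] that by simp
    qed
    moreover have "V - ?N \<subset> V"
      using v(1) by auto
    ultimately obtain I where I: "I \<subseteq> V - ?N" "\<forall>u\<in>I. \<forall>w\<in>I. u \<noteq> w \<longrightarrow> \<not> E u w"
      "card (V - ?N) \<le> (2 * d + 1) * card I"
      using psubset.IH[of "V - ?N"] by blast
    have "finite I" "v \<notin> I"
      using I(1) psubset.hyps finite_subset by blast+
    moreover have "card V = card (V - ?N) + card ?N"
      using card_Diff_subset[OF finite_subset[OF sub psubset.hyps] sub] card_mono[OF psubset.hyps sub]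
      by linarith
    ultimately have "card V \<le> (2 * d + 1) * card (insert v I)"
      using I(3) N by simp
    moreover have "\<forall>u\<in>insert v I. \<forall>w\<in>insert v I. u \<noteq> w \<longrightarrow> \<not> E u w"
      using I(1,2) by blast
    ultimately show ?thesis
      using I(1) v(1) by (intro exI[of _ "insert v I"]) auto
  qed
qed

text \<open>
  Averaging over all transversals \<open>c\<close>. For fixed \<open>i\<close>, the transversals avoided by \<open>T i\<close>
  form a product in which each \<open>L p\<close> met by \<open>T i\<close> contributes one admissible value instead
  of two, so they make up at least a \<open>2\<^bsup>-d\<^esup>\<close> fraction of the total.
\<close>

lemma exists_widely_avoided_transversal:
  assumes fin: "finite M"
    and two: "\<And>p. p \<in> M \<Longrightarrow> card (L p) = 2"
    and nsub: "\<And>p i. p \<in> M \<Longrightarrow> i \<in> M \<Longrightarrow> p \<noteq> i \<Longrightarrow> \<not> L p \<subseteq> T i"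
    and few: "\<And>i. i \<in> M \<Longrightarrow> card {p \<in> M. p \<noteq> i \<and> L p \<inter> T i \<noteq> {}} \<le> d"
  shows "\<exists>c \<in> Pi\<^sub>E M L. card M \<le> 2 ^ d * card {i \<in> M. \<forall>p\<in>M. p \<noteq> i \<longrightarrow> c p \<notin> T i}"
proof -
  let ?C = "Pi\<^sub>E M L"
  let ?good = "\<lambda>i c. \<forall>p\<in>M. p \<noteq> i \<longrightarrow> c p \<notin> T i"
  have finL: "finite (L p)" if "p \<in> M" for p
    using two[OF that] by (intro card_ge_0_finite) simp
  have finC: "finite ?C"
    using fin finL by (intro finite_PiE) auto
  have cardC: "card ?C = 2 ^ card M"
    using fin two by (simp add: card_PiE)
  have "?C \<noteq> {}"
    using cardC by (intro notI) simp
  have many: "2 ^ card M \<le> 2 ^ d * card {c \<in> ?C. ?good i c}" if i: "i \<in> M" for i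
  proof -
    let ?B = "\<lambda>p. if p = i then L p else L p - T i"
    let ?hit = "\<lambda>p. p \<noteq> i \<and> L p \<inter> T i \<noteq> {}"
    have *: "card (?B p) * (if ?hit p then 2 else 1) = 2" if p: "p \<in> M" for p
    proof (cases "?hit p")
      case False
      then show ?thesis
        using two[OF p] by (auto simp: Diff_triv)
    next
      case True
      obtain a b where ab: "L p = {a, b}" "a \<noteq> b"
        using two[OF p] by (auto simp: card_2_iff)
      have "L p - T i = {a} \<or> L p - T i = {b}"
        using True nsub[OF p i] ab by auto
      then have "card (L p - T i) = 1"
        by (elim disjE) simp_all
      then show ?thesis
        using True by simp
    qed
    have "{c \<in> ?C. ?good i c} = Pi\<^sub>E M ?B"
      by (auto simp: PiE_def Pi_def split: if_splits)
    then have "card {c \<in> ?C. ?good i c} * 2 ^ card {p \<in> M. ?hit p}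
        = (\<Prod>p\<in>M. card (?B p)) * (\<Prod>p\<in>M. if ?hit p then 2 else 1)"
      using fin by (simp add: card_PiE prod.If_cases Int_def)
    also have "\<dots> = (\<Prod>p\<in>M. card (?B p) * (if ?hit p then 2 else 1))"
      by (rule prod.distrib[symmetric])
    also have "\<dots> = (\<Prod>p\<in>M. 2)"
      by (rule prod.cong[OF refl *])
    finally have "2 ^ card M = card {c \<in> ?C. ?good i c} * 2 ^ card {p \<in> M. ?hit p}"
      by simp
    also have "\<dots> \<le> card {c \<in> ?C. ?good i c} * 2 ^ d"
      using few[OF i] by (intro mult_le_mono power_increasing) auto
    finally show ?thesis
      by (simp add: mult.commute)
  qed
  have "(\<Sum>c\<in>?C. card M) = (\<Sum>i\<in>M. 2 ^ card M)"
    by (simp add: cardC)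
  also have "\<dots> \<le> (\<Sum>i\<in>M. 2 ^ d * card {c \<in> ?C. ?good i c})"
    by (intro sum_mono many)
  also have "\<dots> = 2 ^ d * (\<Sum>i\<in>M. \<Sum>c\<in>?C. if ?good i c then 1 else 0)"
    using finC by (simp add: sum.If_cases Int_def sum_distrib_left)
  also have "\<dots> = 2 ^ d * (\<Sum>c\<in>?C. \<Sum>i\<in>M. if ?good i c then 1 else 0)"
    by (subst sum.swap) simp
  also have "\<dots> = (\<Sum>c\<in>?C. 2 ^ d * card {i \<in> M. ?good i c})"
    using fin by (simp add: sum.If_cases Int_def sum_distrib_left)
  finally have "\<not> (\<Sum>c\<in>?C. 2 ^ d * card {i \<in> M. ?good i c}) < (\<Sum>c\<in>?C. card M)"
    by simp
  then show ?thesis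
    using sum_strict_mono[OF finC \<open>?C \<noteq> {}\<close>, of "\<lambda>c. 2 ^ d * card {i \<in> M. ?good i c}" "\<lambda>_. card M"]
    by (meson not_less)
qed

lemma card_le_clutter_rank:
  assumes "clutter H" "S \<in> H"
  shows "card S \<le> clutter_rank H"
  using assms by (auto simp: clutter_def clutter_rank_def)

lemma semi_matchingD:
  assumes "semi_matching H M"
  shows "finite M"
    and "p \<in> M \<Longrightarrow> card (fst p) = 2"
    and "p \<in> M \<Longrightarrow> fst p \<subseteq> snd p"
    and "p \<in> M \<Longrightarrow> snd p \<in> H"
    and "p \<in> M \<Longrightarrow> q \<in> M \<Longrightarrow> p \<noteq> q \<Longrightarrow> fst p \<inter> fst q = {}"
    and "p \<in> M \<Longrightarrow> q \<in> M \<Longrightarrow> p \<noteq> q \<Longrightarrow> \<not> fst p \<subseteq> snd q"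
    and "S \<in> H \<Longrightarrow> S \<subseteq> (\<Union>p\<in>M. snd p) \<Longrightarrow> \<exists>p\<in>M. fst p \<subseteq> S"
  using assms unfolding semi_matching_def case_prod_beta by simp_all

text \<open>
  Each \<open>L\<^sub>p\<close> met by \<open>S\<^sub>i\<close> uses up an element of \<open>S\<^sub>i - L\<^sub>i\<close> of its own, the \<open>L\<^sub>p\<close> being
  disjoint. The same bound governs both the probability that \<open>i\<close> is kept and the
  out-degree of \<open>i\<close>.
\<close>

lemma semi_matching_few_hits:
  assumes "clutter H" "semi_matching H M" "i \<in> M"
  shows "card {p \<in> M. p \<noteq> i \<and> fst p \<inter> snd i \<noteq> {}} \<le> clutter_rank H - 2"
proof -
  let ?P = "{p \<in> M. p \<noteq> i \<and> fst p \<inter> snd i \<noteq> {}}"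
  have i: "card (fst i) = 2" "fst i \<subseteq> snd i" "snd i \<in> H"
    using semi_matchingD(2-4)[OF assms(2,3)] by simp_all
  have disj: "fst p \<inter> fst q = {}" if "p \<in> M" "q \<in> M" "p \<noteq> q" for p q
    using semi_matchingD(5)[OF assms(2) that] .
  have fin: "finite (snd i)"
    using assms(1) i(3) by (auto simp: clutter_def)
  define g where "g p = (SOME x. x \<in> fst p \<inter> snd i)" for p :: "nat set \<times> nat set"
  have g: "g p \<in> fst p \<inter> snd i" if "p \<in> ?P" for p
    using that some_in_eq[of "fst p \<inter> snd i"] unfolding g_def by simp
  have "inj_on g ?P"
  proof (rule inj_onI)
    fix p q
    assume "p \<in> ?P" "q \<in> ?P" "g p = g q"
    then show "p = q"
      using g[of p] g[of q] disj[of p q] by auto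
  qed
  moreover have "g ` ?P \<subseteq> snd i - fst i"
    using g disj[OF _ assms(3)] by fastforce
  ultimately have "card ?P \<le> card (snd i - fst i)"
    using fin by (intro card_inj_on_le) auto
  also have "\<dots> = card (snd i) - 2"
    using i fin by (simp add: card_Diff_subset finite_subset)
  finally show ?thesis
    using card_le_clutter_rank[OF assms(1) i(3)] by linarith
qed

text \<open>
  Here \<open>c p\<close> certifies for a discarded pair \<open>p\<close> that \<open>fst p\<close> is not covered by the
  second components kept, so the pair that (4) supplies in \<open>M\<close> lies in \<open>I\<close>.
\<close>

lemma semi_matching_subset:
  assumes M: "semi_matching H M" and "I \<subseteq> M"
    and c: "\<And>p. p \<in> M \<Longrightarrow> c p \<in> fst p"
    and avoid: "\<And>i p. i \<in> I \<Longrightarrow> p \<in> M \<Longrightarrow> p \<noteq> i \<Longrightarrow> c p \<notin> snd i"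
  shows "semi_matching H I"
proof -
  have "\<exists>p\<in>I. fst p \<subseteq> S" if S: "S \<in> H" "S \<subseteq> (\<Union>p\<in>I. snd p)" for S
  proof -
    have "S \<subseteq> (\<Union>p\<in>M. snd p)"
      using S(2) \<open>I \<subseteq> M\<close> by blast
    then obtain p where p: "p \<in> M" "fst p \<subseteq> S"
      using semi_matchingD(7)[OF M S(1)] by blast
    then obtain i where "i \<in> I" "c p \<in> snd i"
      using c S(2) by blast
    then have "p \<in> I"
      using avoid p(1) by blast
    then show ?thesis
      using p(2) by blast
  qed
  moreover have "finite I"
    using semi_matchingD(1)[OF M] \<open>I \<subseteq> M\<close> by (rule rev_finite_subset)
  ultimately show ?thesis
    using semi_matchingD(2-6)[OF M] subsetD[OF \<open>I \<subseteq> M\<close>]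
    unfolding semi_matching_def case_prod_beta by simp
qed

theorem theorem3p4:
  fixes H :: "nat set set" and M :: "(nat set \<times> nat set) set" and r :: nat
  assumes "clutter H"
    and "clutter_rank H \<le> r"
    and "semi_matching H M"
  shows "\<exists>M'. M' \<subseteq> M \<and> expanded_minor_matching H M' \<and>
           real (card M') \<ge> real (card M) * 2 powi (- (int r - 2)) / (2 * real r - 3)"
proof (cases "M = {}")
  case True
  then show ?thesis
    using assms(3) by (intro exI[of _ M]) (auto simp: expanded_minor_matching_def)
next
  case False
  define d where "d = r - 2"
  have finM: "finite M"
    using semi_matchingD(1)[OF assms(3)] .
  \<comment> \<open>A pair of \<open>M\<close> forces \<open>r \<ge> 2\<close>, so that the denominator \<open>2 r - 3\<close> is positive.\<close>
  obtain q where "q \<in> M"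
    using False by blast
  then have q: "card (fst q) = 2" "fst q \<subseteq> snd q" "snd q \<in> H"
    using semi_matchingD(2-4)[OF assms(3)] by simp_all
  have "2 \<le> card (snd q)"
    using q assms(1) card_mono[of "snd q" "fst q"] by (simp add: clutter_def)
  then have r: "r = d + 2"
    using card_le_clutter_rank[OF assms(1) q(3)] assms(2) by (simp add: d_def)
  have few: "card {p \<in> M. p \<noteq> i \<and> fst p \<inter> snd i \<noteq> {}} \<le> d" if "i \<in> M" for i
    using semi_matching_few_hits[OF assms(1,3) that] assms(2) by (simp add: d_def)
  have "\<exists>c \<in> Pi\<^sub>E M fst. card M \<le> 2 ^ d * card {i \<in> M. \<forall>p\<in>M. p \<noteq> i \<longrightarrow> c p \<notin> snd i}"
  proof (rule exists_widely_avoided_transversal[OF finM _ _ few])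
    show "card (fst p) = 2" if "p \<in> M" for p
      using semi_matchingD(2)[OF assms(3) that] .
    show "\<not> fst p \<subseteq> snd i" if "p \<in> M" "i \<in> M" "p \<noteq> i" for p i
      using semi_matchingD(6)[OF assms(3) that] .
  qed
  then obtain c where c: "c \<in> Pi\<^sub>E M fst"
    and cM: "card M \<le> 2 ^ d * card {i \<in> M. \<forall>p\<in>M. p \<noteq> i \<longrightarrow> c p \<notin> snd i}"
    by blast
  define J where "J = {i \<in> M. \<forall>p\<in>M. p \<noteq> i \<longrightarrow> c p \<notin> snd i}"
  have JM: "J \<subseteq> M"
    by (auto simp: J_def)
  have "card {p \<in> J. p \<noteq> i \<and> fst p \<inter> snd i \<noteq> {}} \<le> d" if "i \<in> J" for i
  proof -
    have "card {p \<in> J. p \<noteq> i \<and> fst p \<inter> snd i \<noteq> {}} \<le> card {p \<in> M. p \<noteq> i \<and> fst p \<inter> snd i \<noteq> {}}"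
      using finM JM by (intro card_mono) auto
    then show ?thesis
      using few[of i] that JM by auto
  qed
  then obtain I where I: "I \<subseteq> J"
    "\<forall>i\<in>I. \<forall>p\<in>I. i \<noteq> p \<longrightarrow> \<not> fst p \<inter> snd i \<noteq> {}" "card J \<le> (2 * d + 1) * card I"
    using exists_large_independent_set[of J "\<lambda>i p. fst p \<inter> snd i \<noteq> {}" d]
      finite_subset[OF JM finM] by blast
  have "semi_matching H I"
    using I(1) JM c by (intro semi_matching_subset[OF assms(3), of I c]) (auto simp: J_def)
  then have emm: "expanded_minor_matching H I"
    using I(2) by (auto simp: expanded_minor_matching_def)
  have "card M \<le> 2 ^ d * ((2 * d + 1) * card I)"
    using cM I(3) unfolding J_def[symmetric] by (meson le_trans mult_le_mono2)
  then have bound: "real (card M) \<le> real (2 ^ d * ((2 * d + 1) * card I))"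
    by (simp only: of_nat_le_iff)
  have pow: "2 powi (- (int r - 2)) = (1 / 2 ^ d :: real)"
    by (simp add: r power_int_minus field_simps)
  have denom: "2 * real r - 3 = 2 * real d + 1"
    by (simp add: r)
  have "real (card M) * 2 powi (- (int r - 2)) / (2 * real r - 3) \<le> real (card I)"
    using bound unfolding pow denom by (subst pos_divide_le_eq) (simp_all add: field_simps)
  then show ?thesis
    using I(1) JM emm by blast
qed

end
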